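(* Let $A$ and $B$ be finite sets, and let $G = \mathrm{Sym}(A \times B)$. Then $G = G_R G_L G_R = G_L G_R G_L$.
   Context: $\mathrm{Sym}(X)$ is the group of all permutations of $X$ under composition. $G_L = \{ g \in G : \forall (a,b) \in A \times B\ \exists c \in A:\ g(a,b) = (c,b) \}$ and $G_R = \{ g \in G : \forall (a,b) \in A \times B\ \exists c \in B:\ g(a,b) = (a,c) \}$. For subsets $H, K$ of a group, $HK = \{hk : h \in H, k \in K\}$. Permutations compose right-to-left: $(gh)(x) = g(h(x))$. *)

theory Defs
  imports "HOL-Algebra.Bij" "HOL-Algebra.Coset"
begin

text \<open>
  The group Sym(X) is the library's \<open>BijGroup X\<close>: its elements are the bijections of \<open>X\<close> onto
  itself, normalised to be \<open>undefined\<close> outside \<open>X\<close>, so that each permutation of \<open>X\<close> is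
  represented exactly once. Its product is right-to-left composition on \<open>X\<close>.
\<close>

definition G_L :: "'a set \<Rightarrow> 'b set \<Rightarrow> ('a \<times> 'b \<Rightarrow> 'a \<times> 'b) set" where
  "G_L A B = {g \<in> carrier (BijGroup (A \<times> B)). \<forall>(a, b) \<in> A \<times> B. \<exists>c \<in> A. g (a, b) = (c, b)}"

definition G_R :: "'a set \<Rightarrow> 'b set \<Rightarrow> ('a \<times> 'b \<Rightarrow> 'a \<times> 'b) set" where
  "G_R A B = {g \<in> carrier (BijGroup (A \<times> B)). \<forall>(a, b) \<in> A \<times> B. \<exists>c \<in> B. g (a, b) = (a, c)}"

end

theory Submission
  imports Defs
begin

text \<open>
  To factor \<open>g\<close> as an element of \<open>G_R G_L G_R\<close>, view each point \<open>p\<close> of \<open>A \<times> B\<close> as an edge joining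
  the row of \<open>p\<close> to the row of \<open>g p\<close>. This bipartite multigraph is regular of degree \<open>card B\<close>,
  so by Koenig's edge colouring theorem its edges can be properly coloured with the elements of
  \<open>B\<close>. The factor applied first moves \<open>p\<close> within its row to the column named by its colour, the second
  moves it within that column to the row of \<open>g p\<close>, and the third moves it within that row to
  \<open>g p\<close>. The factorization in \<open>G_L G_R G_L\<close> is obtained by exchanging rows and columns.
\<close>

section \<open>Edge colouring of bipartite multigraphs\<close>

text \<open>The edges \<open>e \<in> E\<close> join \<open>s e\<close> on one side to \<open>t e\<close> on the other.\<close>

definition proper_colouring ::
    "('e \<Rightarrow> 'u) \<Rightarrow> ('e \<Rightarrow> 'v) \<Rightarrow> 'e set \<Rightarrow> 'c set \<Rightarrow> ('e \<Rightarrow> 'c) \<Rightarrow> bool" where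
  "proper_colouring s t E C c \<longleftrightarrow>
     c \<in> E \<rightarrow> C \<and> inj_on (\<lambda>e. (s e, c e)) E \<and> inj_on (\<lambda>e. (t e, c e)) E"

lemma proper_colouring_s:
  "\<lbrakk>proper_colouring s t E C c; x \<in> E; y \<in> E; s x = s y; c x = c y\<rbrakk> \<Longrightarrow> x = y"
  by (auto simp: proper_colouring_def dest: inj_onD)

lemma proper_colouring_t:
  "\<lbrakk>proper_colouring s t E C c; x \<in> E; y \<in> E; t x = t y; c x = c y\<rbrakk> \<Longrightarrow> x = y"
  by (auto simp: proper_colouring_def dest: inj_onD)

lemma inj_on_pair_insert:
  assumes "inj_on (\<lambda>x. (f x, c x)) E" and "\<And>x. \<lbrakk>x \<in> E; f x = f e\<rbrakk> \<Longrightarrow> c x \<noteq> k"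
  shows "inj_on (\<lambda>x. (f x, (c(e := k)) x)) (insert e E)"
proof (rule inj_onI)
  fix x y
  assume "x \<in> insert e E" "y \<in> insert e E" "(f x, (c(e := k)) x) = (f y, (c(e := k)) y)"
  then show "x = y"
    using assms(2)[of x] assms(2)[of y] inj_onD[OF assms(1), of x y]
    by (cases "x = e"; cases "y = e") auto
qed

lemma proper_colouring_insert:
  assumes "proper_colouring s t E C c" and "k \<in> C"
    and "\<And>x. \<lbrakk>x \<in> E; s x = s e\<rbrakk> \<Longrightarrow> c x \<noteq> k" and "\<And>x. \<lbrakk>x \<in> E; t x = t e\<rbrakk> \<Longrightarrow> c x \<noteq> k"
  shows "proper_colouring s t (insert e E) C (c(e := k))"
  using assms inj_on_pair_insert[of s c E e k] inj_on_pair_insert[of t c E e k]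
  by (auto simp: proper_colouring_def)

text \<open>
  Exchanging the colours along the maximal \<open>\<alpha>\<close>-\<open>\<beta>\<close>-alternating path that starts at \<open>u\<close> frees \<open>\<beta>\<close>
  at \<open>u\<close>. Every \<open>\<alpha>\<close>-edge of the path is preceded by a \<open>\<beta>\<close>-edge with the same \<open>t\<close>-end, so the
  path cannot reach the vertex \<open>v\<close>, where \<open>\<beta>\<close> stays free.
\<close>

lemma kempe_swap:
  assumes col: "proper_colouring s t E C c" and \<alpha>: "\<alpha> \<in> C" and \<beta>: "\<beta> \<in> C"
    and u: "\<And>x. \<lbrakk>x \<in> E; s x = u\<rbrakk> \<Longrightarrow> c x \<noteq> \<alpha>"
    and v: "\<And>x. \<lbrakk>x \<in> E; t x = v\<rbrakk> \<Longrightarrow> c x \<noteq> \<beta>"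
  obtains c' where "proper_colouring s t E C c'"
    "\<And>x. \<lbrakk>x \<in> E; s x = u\<rbrakk> \<Longrightarrow> c' x \<noteq> \<beta>" "\<And>x. \<lbrakk>x \<in> E; t x = v\<rbrakk> \<Longrightarrow> c' x \<noteq> \<beta>"
proof (cases "\<alpha> = \<beta>")
  case True
  then show ?thesis using that col u v by blast
next
  case False
  \<comment> \<open>One step along an alternating path directed away from \<open>u\<close>: a
    \<beta>-edge is left through its \<open>t\<close>-end, an \<alpha>-edge through its
    \<open>s\<close>-end.\<close>
  define N where "N = {(x, y). x \<in> E \<and> y \<in> E \<and>
    (c x = \<beta> \<and> c y = \<alpha> \<and> t x = t y \<or> c x = \<alpha> \<and> c y = \<beta> \<and> s x = s y)}"
  define R where "R = N\<^sup>* `` {x \<in> E. s x = u \<and> c x = \<beta>}"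
  have R_cases: "x \<in> E \<and> (s x = u \<and> c x = \<beta> \<or> (\<exists>y \<in> R. (y, x) \<in> N))" if x: "x \<in> R" for x
  proof -
    obtain e where e: "e \<in> E" "s e = u" "c e = \<beta>" "(e, x) \<in> N\<^sup>*"
      using x by (auto simp: R_def)
    from e(4) show ?thesis
    proof (cases rule: rtranclE)
      case base
      then show ?thesis using e by simp
    next
      case (step y)
      then have "y \<in> R" "x \<in> E" using e by (auto simp: R_def N_def)
      then show ?thesis using step by blast
    qed
  qed
  have R_step: "y \<in> R" if "x \<in> R" "(x, y) \<in> N" for x y
    using that unfolding R_def by (blast intro: rtrancl_into_rtrancl)
  have R_colour: "c x = \<alpha> \<or> c x = \<beta>" if "x \<in> R" for x
    using R_cases[OF that] by (auto simp: N_def)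
  \<comment> \<open>Properness allows an edge at most one predecessor, and a \<beta>-edge at
    \<open>u\<close> has none, since that would be an \<alpha>-edge at \<open>u\<close>.\<close>
  have R_pred: "x \<in> R" if xy: "(x, y) \<in> N" and y: "y \<in> R" for x y
  proof -
    have "\<not> (s y = u \<and> c y = \<beta>)"
      using xy u False by (auto simp: N_def)
    then obtain z where z: "z \<in> R" "(z, y) \<in> N"
      using R_cases[OF y] by blast
    have "z = x"
    proof (cases "c y = \<alpha>")
      case True
      then have "z \<in> E" "x \<in> E" "t z = t x" "c z = c x"
        using xy z(2) False unfolding N_def by auto
      then show ?thesis by (rule proper_colouring_t[OF col])
    next
      case y: False
      then have "z \<in> E" "x \<in> E" "s z = s x" "c z = c x"
        using xy z(2) unfolding N_def by auto
      then show ?thesis by (rule proper_colouring_s[OF col])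
    qed
    then show ?thesis using z(1) by simp
  qed
  \<comment> \<open>Two meeting edges of colours \<alpha> and \<beta> are consecutive under
    \<open>N\<close> in one of the two orders, so \<open>R\<close> is closed under such
    adjacency.\<close>
  have R_closed: "y \<in> R"
    if "x \<in> R" "y \<in> E" "s x = s y \<or> t x = t y" "c x \<noteq> c y" "c y = \<alpha> \<or> c y = \<beta>" for x y
  proof -
    have "(x, y) \<in> N \<or> (y, x) \<in> N"
      using that R_colour[OF that(1)] R_cases[OF that(1)] by (auto simp: N_def)
    then show ?thesis using R_step R_pred that(1) by blast
  qed
  define c' where "c' x = (if x \<in> R then if c x = \<alpha> then \<beta> else \<alpha> else c x)" for x
  \<comment> \<open>The exchange creates no conflict: by closure, a clash between different old
    colours would have both edges in \<open>R\<close> or both outside, and there recolouring keeps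
    different colours different.\<close>
  have meet: "c x = c y" if "x \<in> E" "y \<in> E" "s x = s y \<or> t x = t y" "c' x = c' y" for x y
  proof (rule ccontr)
    assume ne: "c x \<noteq> c y"
    have "x \<in> R \<longleftrightarrow> y \<in> R"
      using R_closed[of x y] R_closed[of y x] that ne R_colour[of x] R_colour[of y]
      by (auto simp: c'_def split: if_splits)
    then show False
      using that(4) ne R_colour[of x] R_colour[of y] by (auto simp: c'_def split: if_splits)
  qed
  show ?thesis
  proof
    show "proper_colouring s t E C c'"
      unfolding proper_colouring_def
    proof (intro conjI)
      show "c' \<in> E \<rightarrow> C"
        using col \<alpha> \<beta> by (auto simp: proper_colouring_def c'_def)
      show "inj_on (\<lambda>e. (s e, c' e)) E"
      proof (rule inj_onI)
        fix x y assume "x \<in> E" "y \<in> E" "(s x, c' x) = (s y, c' y)"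
        then show "x = y"
          using meet[of x y] proper_colouring_s[OF col, of x y] by simp
      qed
      show "inj_on (\<lambda>e. (t e, c' e)) E"
      proof (rule inj_onI)
        fix x y assume "x \<in> E" "y \<in> E" "(t x, c' x) = (t y, c' y)"
        then show "x = y"
          using meet[of x y] proper_colouring_t[OF col, of x y] by simp
      qed
    qed
    \<comment> \<open>Any \<beta>-edge at \<open>u\<close> is a starting edge of \<open>R\<close>
      and turns into \<alpha>.\<close>
    show "c' x \<noteq> \<beta>" if "x \<in> E" "s x = u" for x
      using u[OF that] that False by (auto simp: c'_def R_def)
    show "c' x \<noteq> \<beta>" if x: "x \<in> E" "t x = v" for x
    proof
      assume "c' x = \<beta>"
      then have "x \<in> R" "c x = \<alpha>"
        using v[OF x] False by (auto simp: c'_def split: if_splits)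
      then obtain y where "(y, x) \<in> N"
        using R_cases False by blast
      then show False
        using v x \<open>c x = \<alpha>\<close> False by (auto simp: N_def)
    qed
  qed
qed

text \<open>The uncoloured edge \<open>e\<close> takes up one unit of the degree at its end, so the
  edges of \<open>E\<close> there use fewer than \<open>card C\<close> colours.\<close>

lemma colour_missing:
  assumes "finite E" "card {x \<in> insert e E. f x = f e} \<le> card C" "e \<notin> E" "finite C"
  obtains k where "k \<in> C" "\<And>x. \<lbrakk>x \<in> E; f x = f e\<rbrakk> \<Longrightarrow> c x \<noteq> k"
proof -
  let ?F = "{x \<in> E. f x = f e}"
  have "{x \<in> insert e E. f x = f e} = insert e ?F" by auto
  then have "card ?F < card C"
    using assms by simp
  then have "card (c ` ?F) < card C"
    using card_image_le[of ?F c] assms(1) by simp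
  then have "\<not> C \<subseteq> c ` ?F"
    using card_mono[of "c ` ?F" C] assms(1) by auto
  then show ?thesis using that by blast
qed

text \<open>Induction on the edges: colour all but \<open>e\<close>, take a colour \<alpha> free at
  \<open>s e\<close> and \<beta> free at \<open>t e\<close>, make \<beta> free at both by a Kempe
  exchange, and give it to \<open>e\<close>.\<close>

theorem koenig_edge_colouring:
  assumes "finite E" and "finite C"
    and "\<And>e. e \<in> E \<Longrightarrow> card {x \<in> E. s x = s e} \<le> card C"
    and "\<And>e. e \<in> E \<Longrightarrow> card {x \<in> E. t x = t e} \<le> card C"
  shows "\<exists>c. proper_colouring s t E C c"
  using assms(1,3,4)
proof (induction E rule: finite_induct)
  case empty
  then show ?case by (simp add: proper_colouring_def)
next
  case (insert e E)
  have sub: "card {x \<in> E. P x} \<le> card {x \<in> insert e E. P x}" for P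
    using insert.hyps(1) by (intro card_mono) auto
  obtain c where c: "proper_colouring s t E C c"
    using insert.IH insert.prems sub by (meson insertI2 le_trans)
  obtain \<alpha> where \<alpha>: "\<alpha> \<in> C" "\<And>x. \<lbrakk>x \<in> E; s x = s e\<rbrakk> \<Longrightarrow> c x \<noteq> \<alpha>"
    using colour_missing[of E e s C c] insert assms(2) by blast
  obtain \<beta> where \<beta>: "\<beta> \<in> C" "\<And>x. \<lbrakk>x \<in> E; t x = t e\<rbrakk> \<Longrightarrow> c x \<noteq> \<beta>"
    using colour_missing[of E e t C c] insert assms(2) by blast
  show ?case
  proof (rule kempe_swap[OF c \<alpha>(1) \<beta>(1) \<alpha>(2) \<beta>(2)])
    fix c' assume "proper_colouring s t E C c'"
      and "\<And>x. \<lbrakk>x \<in> E; s x = s e\<rbrakk> \<Longrightarrow> c' x \<noteq> \<beta>"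
      and "\<And>x. \<lbrakk>x \<in> E; t x = t e\<rbrakk> \<Longrightarrow> c' x \<noteq> \<beta>"
    then have "proper_colouring s t (insert e E) C (c'(e := \<beta>))"
      using \<beta>(1) by (intro proper_colouring_insert) auto
    then show ?case by blast
  qed
qed

section \<open>Factorization of permutations\<close>

text \<open>A common form of \<open>G_L\<close> (with \<open>snd\<close>) and \<open>G_R\<close>
  (with \<open>fst\<close>), so that one lemma serves both factorizations.\<close>

definition fibre_perms :: "'x set \<Rightarrow> ('x \<Rightarrow> 'y) \<Rightarrow> ('x \<Rightarrow> 'x) set" where
  "fibre_perms X \<phi> = {g \<in> carrier (BijGroup X). \<forall>x \<in> X. \<phi> (g x) = \<phi> x}"

lemma carrier_BijGroup_iff:
  "g \<in> carrier (BijGroup X) \<longleftrightarrow> g \<in> extensional X \<and> bij_betw g X X"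
  by (simp add: BijGroup_def Bij_def)

lemma BijGroup_mem: "\<lbrakk>g \<in> carrier (BijGroup X); x \<in> X\<rbrakk> \<Longrightarrow> g x \<in> X"
  by (auto simp: carrier_BijGroup_iff dest: bij_betwE)

lemma mult_BijGroup_apply:
  "\<lbrakk>g \<in> carrier (BijGroup X); h \<in> carrier (BijGroup X); x \<in> X\<rbrakk>
     \<Longrightarrow> (g \<otimes>\<^bsub>BijGroup X\<^esub> h) x = g (h x)"
  by (simp add: BijGroup_def compose_def)

lemma G_L_eq: "G_L A B = fibre_perms (A \<times> B) snd"
proof -
  have "(\<exists>c \<in> A. g (a, b) = (c, b)) \<longleftrightarrow> snd (g (a, b)) = b"
    if "g \<in> carrier (BijGroup (A \<times> B))" "a \<in> A" "b \<in> B" for g a b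
    using BijGroup_mem[OF that(1), of "(a, b)"] that(2,3) by (cases "g (a, b)") auto
  then show ?thesis unfolding G_L_def fibre_perms_def by auto
qed

lemma G_R_eq: "G_R A B = fibre_perms (A \<times> B) fst"
proof -
  have "(\<exists>c \<in> B. g (a, b) = (a, c)) \<longleftrightarrow> fst (g (a, b)) = a"
    if "g \<in> carrier (BijGroup (A \<times> B))" "a \<in> A" "b \<in> B" for g a b
    using BijGroup_mem[OF that(1), of "(a, b)"] that(2,3) by (cases "g (a, b)") auto
  then show ?thesis unfolding G_R_def fibre_perms_def by auto
qed

text \<open>The quotient sends \<open>h x\<close> to \<open>g x\<close>, and every point of
  \<open>X\<close> is some \<open>h x\<close>.\<close>

lemma divide_mem_fibre_perms:
  assumes "g \<in> carrier (BijGroup X)" "h \<in> carrier (BijGroup X)"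
    and "\<And>x. x \<in> X \<Longrightarrow> \<phi> (g x) = \<phi> (h x)"
  shows "g \<otimes>\<^bsub>BijGroup X\<^esub> inv\<^bsub>BijGroup X\<^esub> h \<in> fibre_perms X \<phi>"
proof -
  interpret group "BijGroup X" by (rule group_BijGroup)
  let ?k = "g \<otimes>\<^bsub>BijGroup X\<^esub> inv\<^bsub>BijGroup X\<^esub> h"
  have k: "?k \<in> carrier (BijGroup X)" using assms by simp
  have "?k \<otimes>\<^bsub>BijGroup X\<^esub> h = g" using assms by (simp add: m_assoc)
  then have kh: "?k (h x) = g x" if "x \<in> X" for x
    using mult_BijGroup_apply[OF k assms(2) that] by simp
  have "\<phi> (?k y) = \<phi> y" if y: "y \<in> X" for y
  proof -
    obtain x where "x \<in> X" "y = h x"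
      using y assms(2) by (auto simp: carrier_BijGroup_iff bij_betw_def)
    then show ?thesis using kh assms(3) by simp
  qed
  then show ?thesis using k by (simp add: fibre_perms_def)
qed

text \<open>Telescoping: \<open>g\<close> is the product of \<open>g\<close> times the inverse of
  \<open>h\<close>, \<open>h\<close> times the inverse of \<open>r\<close>, and \<open>r\<close>.
  Here \<open>r\<close> and \<open>h\<close> record where a point stands after the first and the
  second move.\<close>

lemma factorization:
  assumes "g \<in> carrier (BijGroup X)" "h \<in> carrier (BijGroup X)" "r \<in> carrier (BijGroup X)"
    and "\<And>x. x \<in> X \<Longrightarrow> \<phi> (r x) = \<phi> x"
    and "\<And>x. x \<in> X \<Longrightarrow> \<psi> (h x) = \<psi> (r x)"
    and "\<And>x. x \<in> X \<Longrightarrow> \<phi> (h x) = \<phi> (g x)"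
  shows "g \<in> fibre_perms X \<phi> <#>\<^bsub>BijGroup X\<^esub> fibre_perms X \<psi> <#>\<^bsub>BijGroup X\<^esub> fibre_perms X \<phi>"
proof -
  interpret group "BijGroup X" by (rule group_BijGroup)
  let ?p = "g \<otimes>\<^bsub>BijGroup X\<^esub> inv\<^bsub>BijGroup X\<^esub> h"
  let ?q = "h \<otimes>\<^bsub>BijGroup X\<^esub> inv\<^bsub>BijGroup X\<^esub> r"
  have p: "?p \<in> fibre_perms X \<phi>" and q: "?q \<in> fibre_perms X \<psi>"
    using assms by (simp_all add: divide_mem_fibre_perms)
  have r: "r \<in> fibre_perms X \<phi>"
    using assms by (simp add: fibre_perms_def)
  have "inv\<^bsub>BijGroup X\<^esub> h \<otimes>\<^bsub>BijGroup X\<^esub> (h \<otimes>\<^bsub>BijGroup X\<^esub> y) = y"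
    if "y \<in> carrier (BijGroup X)" for y
    using assms(2) that by (simp flip: m_assoc)
  then have "g = ?p \<otimes>\<^bsub>BijGroup X\<^esub> ?q \<otimes>\<^bsub>BijGroup X\<^esub> r"
    using assms(1-3) by (simp add: m_assoc)
  with p q r show ?thesis
    unfolding set_mult_def by blast
qed

lemma fibre_perms_prod_subset:
  "fibre_perms X \<phi> <#>\<^bsub>BijGroup X\<^esub> fibre_perms X \<psi> <#>\<^bsub>BijGroup X\<^esub> fibre_perms X \<phi>
     \<subseteq> carrier (BijGroup X)"
proof -
  interpret group "BijGroup X" by (rule group_BijGroup)
  have "fibre_perms X \<chi> \<subseteq> carrier (BijGroup X)" for \<chi> :: "'a \<Rightarrow> 'z"
    by (auto simp: fibre_perms_def)
  then show ?thesis by (intro set_mult_closed) (auto simp: fibre_perms_def)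
qed

text \<open>Finiteness makes the injection onto; \<open>restrict\<close> supplies the value
  \<open>undefined\<close> outside \<open>X\<close> that the group requires.\<close>

lemma restrict_inj_mem_BijGroup:
  assumes "finite X" "\<And>x. x \<in> X \<Longrightarrow> f x \<in> X" "inj_on f X"
  shows "restrict f X \<in> carrier (BijGroup X)"
proof -
  have "f ` X = X" using assms by (intro endo_inj_surj) auto
  then have "bij_betw (restrict f X) X X" using assms(3) by (simp add: bij_betw_def inj_on_restrict_eq)
  then show ?thesis by (simp add: carrier_BijGroup_iff)
qed

text \<open>Since \<open>g\<close> maps each fibre of \<open>\<phi> \<circ> g\<close> injectively
  into a fibre of \<open>\<phi>\<close>, the degree bound at the source ends also holds at the
  target ends.\<close>

lemma perm_colouring:
  assumes "finite X" "finite C" "g \<in> carrier (BijGroup X)"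
    and deg: "\<And>x. x \<in> X \<Longrightarrow> card {y \<in> X. \<phi> y = \<phi> x} \<le> card C"
  obtains c where "proper_colouring \<phi> (\<phi> \<circ> g) X C c"
proof -
  have g: "bij_betw g X X" using assms(3) by (simp add: carrier_BijGroup_iff)
  have "card {y \<in> X. \<phi> (g y) = \<phi> (g x)} \<le> card C" if "x \<in> X" for x
  proof -
    have "g ` {y \<in> X. \<phi> (g y) = \<phi> (g x)} \<subseteq> {z \<in> X. \<phi> z = \<phi> (g x)}"
      using g by (auto dest: bij_betwE)
    then have "card {y \<in> X. \<phi> (g y) = \<phi> (g x)} \<le> card {z \<in> X. \<phi> z = \<phi> (g x)}"
      using g assms(1) by (intro card_inj_on_le[of g]) (auto simp: bij_betw_def intro: inj_on_subset)
    also have "\<dots> \<le> card C" using deg g that by (auto dest: bij_betwE)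
    finally show ?thesis .
  qed
  then show ?thesis
    using koenig_edge_colouring[of X C \<phi> "\<phi> \<circ> g"] assms that by auto
qed

theorem theorem2:
  fixes A :: "'a set" and B :: "'b set"
  assumes "finite A" and "finite B"
  shows "carrier (BijGroup (A \<times> B)) =
           G_R A B <#>\<^bsub>BijGroup (A \<times> B)\<^esub> G_L A B <#>\<^bsub>BijGroup (A \<times> B)\<^esub> G_R A B \<and>
         carrier (BijGroup (A \<times> B)) =
           G_L A B <#>\<^bsub>BijGroup (A \<times> B)\<^esub> G_R A B <#>\<^bsub>BijGroup (A \<times> B)\<^esub> G_L A B"
proof -
  let ?X = "A \<times> B"
  have fin: "finite ?X" using assms by simp
  have "g \<in> fibre_perms ?X fst <#>\<^bsub>BijGroup ?X\<^esub> fibre_perms ?X snd <#>\<^bsub>BijGroup ?X\<^esub> fibre_perms ?X fst"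
    and "g \<in> fibre_perms ?X snd <#>\<^bsub>BijGroup ?X\<^esub> fibre_perms ?X fst <#>\<^bsub>BijGroup ?X\<^esub> fibre_perms ?X snd"
    if g: "g \<in> carrier (BijGroup ?X)" for g
  proof -
    have row: "{q \<in> ?X. fst q = fst p} = {fst p} \<times> B"
      and column: "{q \<in> ?X. snd q = snd p} = A \<times> {snd p}" if "p \<in> ?X" for p
      using that by auto
    obtain c where "proper_colouring fst (fst \<circ> g) ?X B c"
      using perm_colouring[OF fin assms(2) g, of fst] row by (auto simp: card_cartesian_product)
    then have c_mem: "\<And>p. p \<in> ?X \<Longrightarrow> c p \<in> B"
      and c_inj: "inj_on (\<lambda>p. (fst p, c p)) ?X" "inj_on (\<lambda>p. (fst (g p), c p)) ?X"
      by (simp_all only: proper_colouring_def Pi_iff o_def)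
    show "g \<in> fibre_perms ?X fst <#>\<^bsub>BijGroup ?X\<^esub> fibre_perms ?X snd <#>\<^bsub>BijGroup ?X\<^esub> fibre_perms ?X fst"
    proof (rule factorization[OF g])
      \<comment> \<open>Properness at the target rows makes this map \<open>h\<close> injective;
        properness at the source rows does so for \<open>r\<close> below.\<close>
      show "(\<lambda>p \<in> ?X. (fst (g p), c p)) \<in> carrier (BijGroup ?X)"
        using c_mem c_inj(2) BijGroup_mem[OF g]
        by (intro restrict_inj_mem_BijGroup[OF fin]) (simp_all only: mem_Times_iff fst_conv snd_conv simp_thms)
      show "(\<lambda>p \<in> ?X. (fst p, c p)) \<in> carrier (BijGroup ?X)"
        using c_mem c_inj(1)
        by (intro restrict_inj_mem_BijGroup[OF fin]) (simp_all only: mem_Times_iff fst_conv snd_conv simp_thms)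
    qed auto
    obtain d where "proper_colouring snd (snd \<circ> g) ?X A d"
      using perm_colouring[OF fin assms(1) g, of snd] column by (auto simp: card_cartesian_product)
    then have d_mem: "\<And>p. p \<in> ?X \<Longrightarrow> d p \<in> A"
      and "inj_on (\<lambda>p. (snd p, d p)) ?X" "inj_on (\<lambda>p. (snd (g p), d p)) ?X"
      by (simp_all only: proper_colouring_def Pi_iff o_def)
    \<comment> \<open>The colour now names a row, so it must become the first coordinate.\<close>
    then have d_inj: "inj_on (\<lambda>p. (d p, snd p)) ?X" "inj_on (\<lambda>p. (d p, snd (g p))) ?X"
      unfolding inj_on_def prod.inject by blast+
    show "g \<in> fibre_perms ?X snd <#>\<^bsub>BijGroup ?X\<^esub> fibre_perms ?X fst <#>\<^bsub>BijGroup ?X\<^esub> fibre_perms ?X snd"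
    proof (rule factorization[OF g])
      show "(\<lambda>p \<in> ?X. (d p, snd (g p))) \<in> carrier (BijGroup ?X)"
        using d_mem d_inj(2) BijGroup_mem[OF g]
        by (intro restrict_inj_mem_BijGroup[OF fin]) (simp_all only: mem_Times_iff fst_conv snd_conv simp_thms)
      show "(\<lambda>p \<in> ?X. (d p, snd p)) \<in> carrier (BijGroup ?X)"
        using d_mem d_inj(1)
        by (intro restrict_inj_mem_BijGroup[OF fin]) (simp_all only: mem_Times_iff fst_conv snd_conv simp_thms)
    qed auto
  qed
  then show ?thesis
    unfolding G_L_eq G_R_eq by (intro conjI equalityI subsetI fibre_perms_prod_subset) blast+
qed

end
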